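(* Let $m_1,\dots,m_7>0$ be the masses of seven bodies with position vectors $r_1,\dots,r_7\in\mathbb{R}^3$. Suppose that: (i) $r_1,r_2,r_3$ are the vertices of a (nondegenerate) equilateral triangle lying in a plane $P$, and $r_4,r_5,r_6$ are the vertices of another equilateral triangle lying in a plane $P'\neq P$ parallel to $P$; (ii) the line $L$ through the center of the first triangle perpendicular to $P$ also passes through the center of the second triangle, and the second triangle is the image of the first one under the rotation by the angle $\pi/3$ about $L$ followed by the orthogonal projection onto $P'$, the vertices being labelled so that $r_4,r_5,r_6$ are diametrically opposite to $r_1,r_2,r_3$ respectively (that is, $r_1+r_4=r_2+r_5=r_3+r_6$); (iii) $r_7$ is the point of $L$ lying between $P$ and $P'$ and equidistant from the two planes. Then the seven bodies form a central configuration if and only if $m_1=m_2=m_3=m_4=m_5=m_6$ and $r_1,r_2,r_3,r_4,r_5,r_6$ are the vertices of a regular octahedron with $r_7$ at its center.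
   Context: Consider $N$ point masses $m_1,\dots,m_N>0$ at pairwise distinct positions $r_1,\dots,r_N\in\mathbb{R}^3$, interacting by Newtonian gravitation (gravitational constant normalized to $1$), and let $$V(r_1,\dots,r_N)=\sum_{1\le i<j\le N}\frac{m_im_j}{\|r_i-r_j\|}.$$ Let $c=\left(\sum_{i=1}^N m_ir_i\right)/\left(\sum_{i=1}^N m_i\right)$ be the center of mass. The bodies form a central configuration if there is a real constant $\lambda$ such that for every $i=1,\dots,N$ $$\frac{1}{m_i}\frac{\partial V}{\partial r_i}=\sum_{j\ne i} m_j\,\frac{r_j-r_i}{\|r_j-r_i\|^3}=\lambda\,(r_i-c),$$ i.e. the Newtonian acceleration of each body equals a common constant times its position vector relative to the center of mass. Up to an isometry of $\mathbb{R}^3$ and relabelling, the configurations in the claim are, with $l>0$ and $d>0$: $r_1=(l,0,-d)$, $r_2=(-l/2,\sqrt3\,l/2,-d)$, $r_3=(-l/2,-\sqrt3\,l/2,-d)$, $r_4=(-l,0,d)$, $r_5=(l/2,-\sqrt3\,l/2,d)$, $r_6=(l/2,\sqrt3\,l/2,d)$, $r_7=(0,0,0)$. *)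

theory Defs
  imports "HOL-Analysis.Analysis"
begin

definition newton_acceleration ::
    "nat \<Rightarrow> (nat \<Rightarrow> real) \<Rightarrow> (nat \<Rightarrow> real ^ 3) \<Rightarrow> nat \<Rightarrow> real ^ 3" where
  "newton_acceleration N m r i =
     (\<Sum>j\<in>{1..N} - {i}. (m j / norm (r j - r i) ^ 3) *\<^sub>R (r j - r i))"

definition center_of_mass ::
    "nat \<Rightarrow> (nat \<Rightarrow> real) \<Rightarrow> (nat \<Rightarrow> real ^ 3) \<Rightarrow> real ^ 3" where
  "center_of_mass N m r =
     (1 / (\<Sum>i\<in>{1..N}. m i)) *\<^sub>R (\<Sum>i\<in>{1..N}. m i *\<^sub>R r i)"

definition central_configuration ::
    "nat \<Rightarrow> (nat \<Rightarrow> real) \<Rightarrow> (nat \<Rightarrow> real ^ 3) \<Rightarrow> bool" where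
  "central_configuration N m r \<longleftrightarrow>
     inj_on r {1..N} \<and>
     (\<exists>lam::real. \<forall>i\<in>{1..N}.
        newton_acceleration N m r i = lam *\<^sub>R (r i - center_of_mass N m r))"

definition equilateral_triangle :: "real ^ 3 \<Rightarrow> real ^ 3 \<Rightarrow> real ^ 3 \<Rightarrow> bool" where
  "equilateral_triangle a b c \<longleftrightarrow>
     a \<noteq> b \<and> dist a b = dist b c \<and> dist b c = dist c a"

definition triangle_center :: "real ^ 3 \<Rightarrow> real ^ 3 \<Rightarrow> real ^ 3 \<Rightarrow> real ^ 3" where
  "triangle_center a b c = (1 / 3) *\<^sub>R (a + b + c)"

definition is_plane :: "(real ^ 3) set \<Rightarrow> bool" where
  "is_plane P \<longleftrightarrow> affine P \<and> aff_dim P = 2"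

definition is_line :: "(real ^ 3) set \<Rightarrow> bool" where
  "is_line L \<longleftrightarrow> affine L \<and> aff_dim L = 1"

definition perpendicular :: "(real ^ 3) set \<Rightarrow> (real ^ 3) set \<Rightarrow> bool" where
  "perpendicular L P \<longleftrightarrow>
     (\<forall>x\<in>L. \<forall>y\<in>L. \<forall>p\<in>P. \<forall>q\<in>P. orthogonal (x - y) (p - q))"

text \<open>Rodrigues' formula for the rotation by \<open>\<theta>\<close> about the line through \<open>p\<close> with unit
  direction \<open>u\<close>.  Replacing \<open>u\<close> by \<open>- u\<close> reverses the sense of rotation, so a line
  (which carries no orientation) has two rotations by a given angle.\<close>

definition rotation_about ::
    "(real ^ 3) set \<Rightarrow> real \<Rightarrow> (real ^ 3 \<Rightarrow> real ^ 3) \<Rightarrow> bool" where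
  "rotation_about L \<theta> f \<longleftrightarrow>
     (\<exists>p u. norm u = 1 \<and> L = {p + t *\<^sub>R u | t. True} \<and>
        f = (\<lambda>x. p + cos \<theta> *\<^sub>R (x - p) + sin \<theta> *\<^sub>R cross3 u (x - p)
                   + ((1 - cos \<theta>) * (u \<bullet> (x - p))) *\<^sub>R u))"

text \<open>A regular octahedron with center \<open>c\<close> is the image of the standard one, the convex hull of
  the six points \<open>\<plusminus> e\<^sub>1, \<plusminus> e\<^sub>2, \<plusminus> e\<^sub>3\<close>, under a similarity taking the origin to \<open>c\<close>.\<close>

definition regular_octahedron :: "real ^ 3 \<Rightarrow> (real ^ 3) set \<Rightarrow> bool" where
  "regular_octahedron c K \<longleftrightarrow>
     (\<exists>a::real. \<exists>f::real ^ 3 \<Rightarrow> real ^ 3. a > 0 \<and> orthogonal_transformation f \<and>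
        K = (\<lambda>x. c + a *\<^sub>R f x) ` (convex hull (Basis \<union> uminus ` Basis)))"

definition polytope_vertices :: "(real ^ 3) set \<Rightarrow> (real ^ 3) set" where
  "polytope_vertices K = {v. v extreme_point_of K}"

end

theory Submission
  imports Defs
begin

text \<open>The hypotheses make \<open>r\<^sub>7\<close> the common midpoint of the pairs \<open>r\<^sub>i, r\<^sub>i\<^sub>+\<^sub>3\<close>, so that the
  six outer bodies are \<open>r\<^sub>7 \<plusminus> a, r\<^sub>7 \<plusminus> b, r\<^sub>7 \<plusminus> c\<close> with linearly independent \<open>a, b, c\<close> of equal
  length \<open>\<rho>\<close> and equal mutual inner products \<open>g\<close>; they form a regular octahedron iff \<open>g = 0\<close>.
  Let \<open>D = \<bar>a - b\<bar>\<close> and \<open>E = \<bar>a + b\<bar>\<close>. Comparing the coefficients of \<open>b\<close> in the equations of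
  bodies 1 and 4 gives \<open>(m\<^sub>2 + m\<^sub>5)(1/D\<^sup>3 - 1/E\<^sup>3) = 0\<close>, hence \<open>D = E\<close> and \<open>g = 0\<close>.  Then
  \<open>m\<^sub>i \<noteq> m\<^sub>i\<^sub>+\<^sub>3\<close> would force \<open>D = \<rho>\<close> by the equation of body 7, whereas \<open>D = \<surd>2 \<rho>\<close>; the
  radial coefficients finally force \<open>m\<^sub>1 = m\<^sub>2 = m\<^sub>3\<close>.\<close>

section \<open>Vertices of a regular octahedron\<close>

text \<open>Strict convexity of the ball: every interior point of a segment is strictly closer to
  \<open>c\<close> than one of its endpoints, and all points of the hull have distance at most
  \<rho> from \<open>c\<close>. So a point at distance exactly \<rho> lies inside no segment of the
  hull.\<close>

lemma extreme_points_convex_hull_sphere: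
  fixes S :: "'a::euclidean_space set"
  assumes "S \<subseteq> sphere c \<rho>"
  shows "{v. v extreme_point_of convex hull S} = S"
proof (intro equalityI subsetI)
  fix v assume v: "v \<in> S"
  have "convex hull S \<subseteq> cball c \<rho>"
    using assms by (intro hull_minimal) (auto simp: sphere_def)
  moreover have "dist c v = \<rho>"
    using v assms by auto
  ultimately have "v \<notin> open_segment x y" if "x \<in> convex hull S" "y \<in> convex hull S" for x y
    using dist_decreases_open_segment[of v x y c] that by fastforce
  then show "v \<in> {v. v extreme_point_of convex hull S}"
    using v by (auto simp: extreme_point_of_def hull_inc)
qed (use extreme_point_of_convex_hull in auto)

text \<open>A similarity commutes with the convex hull and sends the six points \<plusminus> e_i to
  a sphere about \<open>p\<close>, so each of them remains extreme.\<close>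

lemma polytope_vertices_similar_octahedron:
  fixes f :: "real ^ 3 \<Rightarrow> real ^ 3"
  assumes "orthogonal_transformation f"
  shows "polytope_vertices ((\<lambda>x. p + \<alpha> *\<^sub>R f x) ` (convex hull (Basis \<union> uminus ` Basis)))
    = (\<lambda>x. p + \<alpha> *\<^sub>R f x) ` (Basis \<union> uminus ` Basis)"
proof -
  let ?h = "\<lambda>x. p + \<alpha> *\<^sub>R f x" and ?B = "Basis \<union> uminus ` Basis :: (real ^ 3) set"
  have lin: "linear (\<lambda>x. \<alpha> *\<^sub>R f x)"
    using assms by (intro linear_compose_scale_right) (simp add: orthogonal_transformation_linear)
  \<comment> \<open>The affine map is split into a linear map and a translation, each of which
    commutes with the hull.\<close>
  have im: "?h ` X = (+) p ` (\<lambda>x. \<alpha> *\<^sub>R f x) ` X" for X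
    by (simp add: image_image)
  have "?h ` (convex hull ?B) = convex hull (?h ` ?B)"
    unfolding im convex_hull_linear_image[OF lin] convex_hull_translation ..
  moreover have "?h ` ?B \<subseteq> sphere p \<bar>\<alpha>\<bar>"
    using assms by (auto simp: dist_norm orthogonal_transformation_norm norm_Basis)
  ultimately show ?thesis
    unfolding polytope_vertices_def by (simp add: extreme_points_convex_hull_sphere)
qed

lemma Basis_real3: "(Basis :: (real ^ 3) set) = {axis 1 1, axis 2 1, axis 3 1}"
  by (auto simp: Basis_vec_def UNIV_3)

text \<open>Provides the orthogonal map that carries the standard octahedron to one with prescribed
  orthonormal axes.\<close>

lemma orthogonal_transformation_frame:
  fixes a b c :: "real ^ 3"
  assumes "norm a = 1" "norm b = 1" "norm c = 1" "a \<bullet> b = 0" "b \<bullet> c = 0" "c \<bullet> a = 0"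
  shows "orthogonal_transformation (\<lambda>x::real ^ 3. x $ 1 *\<^sub>R a + x $ 2 *\<^sub>R b + x $ 3 *\<^sub>R c)"
  unfolding orthogonal_transformation_def
proof (intro conjI allI)
  show "linear (\<lambda>x::real ^ 3. x $ 1 *\<^sub>R a + x $ 2 *\<^sub>R b + x $ 3 *\<^sub>R c)"
    by (intro linearI) (auto simp: algebra_simps)
  have "a \<bullet> a = 1" "b \<bullet> b = 1" "c \<bullet> c = 1"
    using assms by (simp_all add: dot_square_norm)
  then have "(v $ 1 *\<^sub>R a + v $ 2 *\<^sub>R b + v $ 3 *\<^sub>R c) \<bullet> (w $ 1 *\<^sub>R a + w $ 2 *\<^sub>R b + w $ 3 *\<^sub>R c)
      = v $ 1 * w $ 1 + v $ 2 * w $ 2 + v $ 3 * w $ 3" for v w :: "real ^ 3"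
    using assms by (simp add: inner_add_left inner_add_right inner_commute)
  then show "(v $ 1 *\<^sub>R a + v $ 2 *\<^sub>R b + v $ 3 *\<^sub>R c) \<bullet> (w $ 1 *\<^sub>R a + w $ 2 *\<^sub>R b + w $ 3 *\<^sub>R c)
      = v \<bullet> w" for v w :: "real ^ 3"
    by (simp add: inner_vec_def sum_3)
qed

text \<open>Two octahedron vertices that are neither equal nor opposite are seen from the center at
  a right angle, which forces \<open>g = 0\<close>. Conversely, if \<open>g = 0\<close> then
  \<open>a\<close>, \<open>b\<close>, \<open>c\<close> divided by \<rho> form an orthonormal
  frame.\<close>

lemma regular_octahedron_vertices_iff:
  fixes a b c p :: "real ^ 3"
  assumes "norm a = \<rho>" "norm b = \<rho>" "norm c = \<rho>" "\<rho> > 0"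
    and inner: "a \<bullet> b = g" "b \<bullet> c = g" "c \<bullet> a = g"
    and ne: "a \<noteq> b" "a \<noteq> - b"
  shows "(\<exists>K. regular_octahedron p K \<and>
      {p + a, p + b, p + c, p - a, p - b, p - c} = polytope_vertices K) \<longleftrightarrow> g = 0"
proof
  assume "\<exists>K. regular_octahedron p K \<and>
      {p + a, p + b, p + c, p - a, p - b, p - c} = polytope_vertices K"
  then obtain K where K: "regular_octahedron p K"
    "{p + a, p + b, p + c, p - a, p - b, p - c} = polytope_vertices K"
    by blast
  from K(1) obtain \<alpha> and f :: "real ^ 3 \<Rightarrow> real ^ 3" where f: "orthogonal_transformation f"
    and "K = (\<lambda>x. p + \<alpha> *\<^sub>R f x) ` (convex hull (Basis \<union> uminus ` Basis))"
    unfolding regular_octahedron_def by blast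
  with K(2) have eq: "{p + a, p + b, p + c, p - a, p - b, p - c}
      = (\<lambda>x. p + \<alpha> *\<^sub>R f x) ` (Basis \<union> uminus ` Basis)"
    by (simp only: polytope_vertices_similar_octahedron)
  have "p + a \<in> (\<lambda>x. p + \<alpha> *\<^sub>R f x) ` (Basis \<union> uminus ` Basis)"
    "p + b \<in> (\<lambda>x. p + \<alpha> *\<^sub>R f x) ` (Basis \<union> uminus ` Basis)"
    unfolding eq[symmetric] by auto
  then obtain x y where x: "x \<in> Basis \<union> uminus ` Basis" "a = \<alpha> *\<^sub>R f x"
    and y: "y \<in> Basis \<union> uminus ` Basis" "b = \<alpha> *\<^sub>R f y"
    unfolding image_iff add_left_cancel by blast
  have "f (- y) = - f y"
    using f by (simp add: linear_neg orthogonal_transformation_linear)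
  \<comment> \<open>Hence \<open>x\<close> and \<open>y\<close> are signed unit vectors on different
    axes.\<close>
  with ne x y have "x \<noteq> y" "x \<noteq> - y"
    by auto
  with x(1) y(1) have "x \<bullet> y = 0"
    by (auto simp: inner_not_same_Basis)
  with f have "f x \<bullet> f y = 0"
    by (simp add: orthogonal_transformation_def)
  with inner x y show "g = 0"
    by auto
next
  assume "g = 0"
  define f where "f = (\<lambda>x::real ^ 3. x $ 1 *\<^sub>R (a /\<^sub>R \<rho>) + x $ 2 *\<^sub>R (b /\<^sub>R \<rho>) + x $ 3 *\<^sub>R (c /\<^sub>R \<rho>))"
  have f: "orthogonal_transformation f"
    unfolding f_def using assms \<open>g = 0\<close> by (intro orthogonal_transformation_frame) auto
  define K where "K = (\<lambda>x. p + \<rho> *\<^sub>R f x) ` (convex hull (Basis \<union> uminus ` Basis))"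
  have "regular_octahedron p K"
    unfolding regular_octahedron_def K_def using f \<open>\<rho> > 0\<close> by blast
  have "\<rho> *\<^sub>R f (axis 1 1) = a" "\<rho> *\<^sub>R f (axis 2 1) = b" "\<rho> *\<^sub>R f (axis 3 1) = c"
    using \<open>\<rho> > 0\<close> by (simp_all add: f_def axis_def)
  moreover from this have "\<rho> *\<^sub>R f (- axis 1 1) = - a" "\<rho> *\<^sub>R f (- axis 2 1) = - b" "\<rho> *\<^sub>R f (- axis 3 1) = - c"
    using f by (simp_all add: linear_neg orthogonal_transformation_linear)
  ultimately have "(\<lambda>x. p + \<rho> *\<^sub>R f x) ` (Basis \<union> uminus ` Basis) =
      {p + a, p + b, p + c, p - a, p - b, p - c}"
    by (simp add: Basis_real3 image_Un insert_commute)
  then have "polytope_vertices K = {p + a, p + b, p + c, p - a, p - b, p - c}"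
    unfolding K_def by (simp only: polytope_vertices_similar_octahedron[OF f])
  with \<open>regular_octahedron p K\<close> show "\<exists>K. regular_octahedron p K \<and>
      {p + a, p + b, p + c, p - a, p - b, p - c} = polytope_vertices K"
    by metis
qed

section \<open>Comparing coefficients along \<open>a\<close>, \<open>b\<close>, \<open>c\<close>,
  and expanding sums over seven bodies\<close>

text \<open>The Gram matrix has eigenvalues \<open>R - g\<close> (twice) and
  \<open>R + 2 * g\<close>, all positive. The form as an equivalence lets it rewrite a vector
  equation into three scalar ones.\<close>

lemma gram_independent:
  fixes a b c :: "'a::real_inner"
  assumes "a \<bullet> a = R" "b \<bullet> b = R" "c \<bullet> c = R"
    and "a \<bullet> b = g" "b \<bullet> c = g" "c \<bullet> a = g" "g < R" "R + 2 * g > 0"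
  shows "x *\<^sub>R a + y *\<^sub>R b + z *\<^sub>R c = x' *\<^sub>R a + y' *\<^sub>R b + z' *\<^sub>R c
    \<longleftrightarrow> x = x' \<and> y = y' \<and> z = z'"
proof
  assume eq: "x *\<^sub>R a + y *\<^sub>R b + z *\<^sub>R c = x' *\<^sub>R a + y' *\<^sub>R b + z' *\<^sub>R c"
  have "v \<bullet> (x *\<^sub>R a + y *\<^sub>R b + z *\<^sub>R c) = v \<bullet> (x' *\<^sub>R a + y' *\<^sub>R b + z' *\<^sub>R c)" for v
    using eq by simp
  from this[of a] this[of b] this[of c]
  have 1: "x * R + y * g + z * g = x' * R + y' * g + z' * g"
    "x * g + y * R + z * g = x' * g + y' * R + z' * g"
    "x * g + y * g + z * R = x' * g + y' * g + z' * R"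
    using assms by (simp_all add: inner_add_right inner_commute)
  \<comment> \<open>Differences of consecutive rows isolate the eigenvalue \<open>R - g\<close>;
    once the three coefficient differences agree, a single row yields the eigenvalue
    \<open>R + 2 * g\<close>.\<close>
  then have "((x - x') - (y - y')) * (R - g) = 0" "((y - y') - (z - z')) * (R - g) = 0"
    by (simp_all add: algebra_simps)
  with assms have 2: "x - x' = y - y'" "y - y' = z - z'"
    by auto
  have "(x - x') * R + (y - y') * g + (z - z') * g = 0"
    using 1(1) by (simp add: algebra_simps)
  then have "(x - x') * (R + 2 * g) = 0"
    unfolding 2 by (simp add: algebra_simps)
  with assms 2 show "x = x' \<and> y = y' \<and> z = z'"
    by auto
qed simp

lemma sum_upto_7_diff:
  fixes f :: "nat \<Rightarrow> 'a::comm_monoid_add"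
  shows "sum f {1..7} = f 1 + f 2 + f 3 + f 4 + f 5 + f 6 + f 7"
    "sum f ({1..7} - {1}) = f 2 + f 3 + f 4 + f 5 + f 6 + f 7"
    "sum f ({1..7} - {2}) = f 1 + f 3 + f 4 + f 5 + f 6 + f 7"
    "sum f ({1..7} - {3}) = f 1 + f 2 + f 4 + f 5 + f 6 + f 7"
    "sum f ({1..7} - {4}) = f 1 + f 2 + f 3 + f 5 + f 6 + f 7"
    "sum f ({1..7} - {5}) = f 1 + f 2 + f 3 + f 4 + f 6 + f 7"
    "sum f ({1..7} - {6}) = f 1 + f 2 + f 3 + f 4 + f 5 + f 7"
    "sum f ({1..7} - {7}) = f 1 + f 2 + f 3 + f 4 + f 5 + f 6"
proof -
  have "{1..7} = {1, 2, 3, 4, 5, 6, 7::nat}"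
    by auto
  then show "sum f {1..7} = f 1 + f 2 + f 3 + f 4 + f 5 + f 6 + f 7"
    "sum f ({1..7} - {1}) = f 2 + f 3 + f 4 + f 5 + f 6 + f 7"
    "sum f ({1..7} - {2}) = f 1 + f 3 + f 4 + f 5 + f 6 + f 7"
    "sum f ({1..7} - {3}) = f 1 + f 2 + f 4 + f 5 + f 6 + f 7"
    "sum f ({1..7} - {4}) = f 1 + f 2 + f 3 + f 5 + f 6 + f 7"
    "sum f ({1..7} - {5}) = f 1 + f 2 + f 3 + f 4 + f 6 + f 7"
    "sum f ({1..7} - {6}) = f 1 + f 2 + f 3 + f 4 + f 5 + f 7"
    "sum f ({1..7} - {7}) = f 1 + f 2 + f 3 + f 4 + f 5 + f 6"
    by (simp_all add: insert_Diff_if ac_simps)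
qed

lemma ball_upto_7:
  "(\<forall>i\<in>{1..7::nat}. Q i) \<longleftrightarrow> Q 1 \<and> Q 2 \<and> Q 3 \<and> Q 4 \<and> Q 5 \<and> Q 6 \<and> Q 7"
proof -
  have "{1..7} = {1, 2, 3, 4, 5, 6, 7::nat}"
    by auto
  then show ?thesis
    by simp
qed

section \<open>The equations of a central configuration in the basis \<open>a\<close>,
  \<open>b\<close>, \<open>c\<close>\<close>

text \<open>Since \<open>a\<close>, \<open>b\<close>, \<open>c\<close> are independent, the seven
  vector equations split into 21 scalar equations that are linear in the masses.\<close>

lemma antiprism_central_configuration_iff:
  fixes m :: "nat \<Rightarrow> real" and r :: "nat \<Rightarrow> real ^ 3" and a b c :: "real ^ 3"
  assumes masses: "\<And>i. i \<in> {1..7} \<Longrightarrow> m i > 0"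
    and r: "r 1 = r 7 + a" "r 2 = r 7 + b" "r 3 = r 7 + c"
      "r 4 = r 7 - a" "r 5 = r 7 - b" "r 6 = r 7 - c"
    and gram: "a \<bullet> a = R" "b \<bullet> b = R" "c \<bullet> c = R"
      "a \<bullet> b = g" "b \<bullet> c = g" "c \<bullet> a = g" "g < R" "R + 2 * g > 0"
  shows "central_configuration 7 m r \<longleftrightarrow>
    m 1 = m 2 \<and> m 2 = m 3 \<and> m 3 = m 4 \<and> m 4 = m 5 \<and> m 5 = m 6 \<and> g = 0"
proof -
  \<comment> \<open>Only four distances occur: \<open>D\<close> within a triangle, \<open>E\<close>
    between non-opposite bodies of different triangles, \<rho> from the center, and
    \<open>2 * \<rho>\<close> between opposite bodies.\<close>
  define D E \<rho> where "D = sqrt (2 * (R - g))" and "E = sqrt (2 * (R + g))" and "\<rho> = sqrt R"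
  define k h w where "k = 1 / D ^ 3" and "h = 1 / E ^ 3" and "w = 1 / \<rho> ^ 3"
  define M where "M = m 1 + m 2 + m 3 + m 4 + m 5 + m 6 + m 7"
  have pos: "m 1 > 0" "m 2 > 0" "m 3 > 0" "m 4 > 0" "m 5 > 0" "m 6 > 0" "m 7 > 0"
    using masses by auto
  then have M: "M > 0"
    by (simp add: M_def)
  have "R > 0" "R + g > 0"
    using gram by linarith+
  then have DE: "D > 0" "E > 0" "\<rho> > 0"
    using gram by (auto simp: D_def E_def \<rho>_def)
  then have kw: "k > 0" "h > 0" "w > 0"
    by (auto simp: k_def h_def w_def)
  have norms: "norm a = \<rho>" "norm b = \<rho>" "norm c = \<rho>"
      "norm (b - a) = D" "norm (a - b) = D" "norm (b - c) = D"
      "norm (c - b) = D" "norm (c - a) = D" "norm (a - c) = D"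
      "norm (a + b) = E" "norm (b + a) = E" "norm (b + c) = E"
      "norm (c + b) = E" "norm (c + a) = E" "norm (a + c) = E"
    using gram by (simp_all add: norm_eq_sqrt_inner D_def E_def \<rho>_def inner_diff_left
        inner_diff_right inner_add_left inner_add_right inner_commute)
  note indep = gram_independent[OF gram]
  \<comment> \<open>The fresh name keeps the equation for \<open>r 7\<close> below from rewriting
    its own right-hand side. With every position written as \<open>p\<close> plus a combination,
    distinctness reduces to distinct coefficient triples.\<close>
  obtain p where r7: "r 7 = p"
    by simp
  have "r 1 = p + (1 *\<^sub>R a + 0 *\<^sub>R b + 0 *\<^sub>R c)"
    "r 2 = p + (0 *\<^sub>R a + 1 *\<^sub>R b + 0 *\<^sub>R c)"
    "r 3 = p + (0 *\<^sub>R a + 0 *\<^sub>R b + 1 *\<^sub>R c)"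
    "r 4 = p + (- 1 *\<^sub>R a + 0 *\<^sub>R b + 0 *\<^sub>R c)"
    "r 5 = p + (0 *\<^sub>R a + - 1 *\<^sub>R b + 0 *\<^sub>R c)"
    "r 6 = p + (0 *\<^sub>R a + 0 *\<^sub>R b + - 1 *\<^sub>R c)"
    "r 7 = p + (0 *\<^sub>R a + 0 *\<^sub>R b + 0 *\<^sub>R c)"
    using r r7 by (simp_all del: One_nat_def)
  then have inj: "inj_on r {1..7}"
    unfolding inj_on_def ball_upto_7 by (simp only: add_left_cancel[of p] indep) simp
  have com: "center_of_mass 7 m r - r 7 =
      ((m 1 - m 4) / M) *\<^sub>R a + ((m 2 - m 5) / M) *\<^sub>R b + ((m 3 - m 6) / M) *\<^sub>R c"
  proof -
    have "(\<Sum>i\<in>{1..7}. m i *\<^sub>R r i) = M *\<^sub>R r 7 +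
        ((m 1 - m 4) *\<^sub>R a + (m 2 - m 5) *\<^sub>R b + (m 3 - m 6) *\<^sub>R c)"
      unfolding sum_upto_7_diff r M_def by (simp add: algebra_simps)
    then show ?thesis
      unfolding center_of_mass_def sum_upto_7_diff(1)[of m] M_def[symmetric] using M
      by (simp add: scaleR_add_right del: One_nat_def)
  qed
  \<comment> \<open>Allows the acceleration sums to be matched term by term, each displacement
    simplified together with its length.\<close>
  have force: "(x / norm v ^ 3) *\<^sub>R v = (x / d ^ 3) *\<^sub>R v'" if "v = v'" "norm v' = d"
    for x d :: real and v v' :: "real ^ 3"
    using that by simp
  have dbl: "norm (2 *\<^sub>R v) = 2 * norm v" "norm (- 2 *\<^sub>R v) = 2 * norm v"
    for v :: "real ^ 3"
    by simp_all
  have diff: "x - v - (x + v) = - 2 *\<^sub>R v" "x + v - (x - v) = 2 *\<^sub>R v" for x v :: "real ^ 3"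
    by (simp_all add: scaleR_2)
  have neg: "norm (- v - v') = norm (v + v')" for v v' :: "real ^ 3"
    using norm_minus_cancel[of "v + v'"] by (simp del: norm_minus_cancel)
  \<comment> \<open>The term \<open>m 4 * w / 4\<close> comes from the opposite body at distance
    \<open>2 * \<rho>\<close>: displacement \<open>- 2 *\<^sub>R a\<close> divided by
    \<open>8 * \<rho> ^ 3\<close>. Bodies 2 to 6 follow the same pattern.\<close>
  have acc1: "newton_acceleration 7 m r 1 =
      (- ((m 2 + m 3) * k + (m 5 + m 6) * h + m 4 * w / 4 + m 7 * w)) *\<^sub>R a +
      (m 2 * k - m 5 * h) *\<^sub>R b +
      (m 3 * k - m 6 * h) *\<^sub>R c"
  proof -
    have "newton_acceleration 7 m r 1 =
      (m 2 / D ^ 3) *\<^sub>R (b - a) +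
      (m 3 / D ^ 3) *\<^sub>R (c - a) +
      (m 4 / (2 * \<rho>) ^ 3) *\<^sub>R (- 2 *\<^sub>R a) +
      (m 5 / E ^ 3) *\<^sub>R (- b - a) +
      (m 6 / E ^ 3) *\<^sub>R (- c - a) +
      (m 7 / \<rho> ^ 3) *\<^sub>R (- a)"
      unfolding newton_acceleration_def sum_upto_7_diff r
      by (intro arg_cong2[of _ _ _ _ "(+)"] force)
        (simp_all add: norms dbl neg diff)
    then show ?thesis
      by (simp add: k_def h_def w_def power_mult_distrib algebra_simps add_divide_distrib diff_divide_distrib)
  qed
  have acc2: "newton_acceleration 7 m r 2 =
      (m 1 * k - m 4 * h) *\<^sub>R a +
      (- ((m 1 + m 3) * k + (m 4 + m 6) * h + m 5 * w / 4 + m 7 * w)) *\<^sub>R b +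
      (m 3 * k - m 6 * h) *\<^sub>R c"
  proof -
    have "newton_acceleration 7 m r 2 =
      (m 1 / D ^ 3) *\<^sub>R (a - b) +
      (m 3 / D ^ 3) *\<^sub>R (c - b) +
      (m 4 / E ^ 3) *\<^sub>R (- a - b) +
      (m 5 / (2 * \<rho>) ^ 3) *\<^sub>R (- 2 *\<^sub>R b) +
      (m 6 / E ^ 3) *\<^sub>R (- c - b) +
      (m 7 / \<rho> ^ 3) *\<^sub>R (- b)"
      unfolding newton_acceleration_def sum_upto_7_diff r
      by (intro arg_cong2[of _ _ _ _ "(+)"] force)
        (simp_all add: norms dbl neg diff)
    then show ?thesis
      by (simp add: k_def h_def w_def power_mult_distrib algebra_simps add_divide_distrib diff_divide_distrib)
  qed
  have acc3: "newton_acceleration 7 m r 3 =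
      (m 1 * k - m 4 * h) *\<^sub>R a +
      (m 2 * k - m 5 * h) *\<^sub>R b +
      (- ((m 1 + m 2) * k + (m 4 + m 5) * h + m 6 * w / 4 + m 7 * w)) *\<^sub>R c"
  proof -
    have "newton_acceleration 7 m r 3 =
      (m 1 / D ^ 3) *\<^sub>R (a - c) +
      (m 2 / D ^ 3) *\<^sub>R (b - c) +
      (m 4 / E ^ 3) *\<^sub>R (- a - c) +
      (m 5 / E ^ 3) *\<^sub>R (- b - c) +
      (m 6 / (2 * \<rho>) ^ 3) *\<^sub>R (- 2 *\<^sub>R c) +
      (m 7 / \<rho> ^ 3) *\<^sub>R (- c)"
      unfolding newton_acceleration_def sum_upto_7_diff r
      by (intro arg_cong2[of _ _ _ _ "(+)"] force)
        (simp_all add: norms dbl neg diff)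
    then show ?thesis
      by (simp add: k_def h_def w_def power_mult_distrib algebra_simps add_divide_distrib diff_divide_distrib)
  qed
  have acc4: "newton_acceleration 7 m r 4 =
      ((m 5 + m 6) * k + (m 2 + m 3) * h + m 1 * w / 4 + m 7 * w) *\<^sub>R a +
      (m 2 * h - m 5 * k) *\<^sub>R b +
      (m 3 * h - m 6 * k) *\<^sub>R c"
  proof -
    have "newton_acceleration 7 m r 4 =
      (m 1 / (2 * \<rho>) ^ 3) *\<^sub>R (2 *\<^sub>R a) +
      (m 2 / E ^ 3) *\<^sub>R (b + a) +
      (m 3 / E ^ 3) *\<^sub>R (c + a) +
      (m 5 / D ^ 3) *\<^sub>R (- b + a) +
      (m 6 / D ^ 3) *\<^sub>R (- c + a) +
      (m 7 / \<rho> ^ 3) *\<^sub>R (a)"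
      unfolding newton_acceleration_def sum_upto_7_diff r
      by (intro arg_cong2[of _ _ _ _ "(+)"] force)
        (simp_all add: norms dbl neg diff)
    then show ?thesis
      by (simp add: k_def h_def w_def power_mult_distrib algebra_simps add_divide_distrib diff_divide_distrib)
  qed
  have acc5: "newton_acceleration 7 m r 5 =
      (m 1 * h - m 4 * k) *\<^sub>R a +
      ((m 4 + m 6) * k + (m 1 + m 3) * h + m 2 * w / 4 + m 7 * w) *\<^sub>R b +
      (m 3 * h - m 6 * k) *\<^sub>R c"
  proof -
    have "newton_acceleration 7 m r 5 =
      (m 1 / E ^ 3) *\<^sub>R (a + b) +
      (m 2 / (2 * \<rho>) ^ 3) *\<^sub>R (2 *\<^sub>R b) +
      (m 3 / E ^ 3) *\<^sub>R (c + b) +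
      (m 4 / D ^ 3) *\<^sub>R (- a + b) +
      (m 6 / D ^ 3) *\<^sub>R (- c + b) +
      (m 7 / \<rho> ^ 3) *\<^sub>R (b)"
      unfolding newton_acceleration_def sum_upto_7_diff r
      by (intro arg_cong2[of _ _ _ _ "(+)"] force)
        (simp_all add: norms dbl neg diff)
    then show ?thesis
      by (simp add: k_def h_def w_def power_mult_distrib algebra_simps add_divide_distrib diff_divide_distrib)
  qed
  have acc6: "newton_acceleration 7 m r 6 =
      (m 1 * h - m 4 * k) *\<^sub>R a +
      (m 2 * h - m 5 * k) *\<^sub>R b +
      ((m 4 + m 5) * k + (m 1 + m 2) * h + m 3 * w / 4 + m 7 * w) *\<^sub>R c"
  proof -
    have "newton_acceleration 7 m r 6 =
      (m 1 / E ^ 3) *\<^sub>R (a + c) +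
      (m 2 / E ^ 3) *\<^sub>R (b + c) +
      (m 3 / (2 * \<rho>) ^ 3) *\<^sub>R (2 *\<^sub>R c) +
      (m 4 / D ^ 3) *\<^sub>R (- a + c) +
      (m 5 / D ^ 3) *\<^sub>R (- b + c) +
      (m 7 / \<rho> ^ 3) *\<^sub>R (c)"
      unfolding newton_acceleration_def sum_upto_7_diff r
      by (intro arg_cong2[of _ _ _ _ "(+)"] force)
        (simp_all add: norms dbl neg diff)
    then show ?thesis
      by (simp add: k_def h_def w_def power_mult_distrib algebra_simps add_divide_distrib diff_divide_distrib)
  qed
  \<comment> \<open>At the center, opposite bodies pull along the same line, so only mass
    differences survive.\<close>
  have acc7: "newton_acceleration 7 m r 7 =
      ((m 1 - m 4) * w) *\<^sub>R a +
      ((m 2 - m 5) * w) *\<^sub>R b +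
      ((m 3 - m 6) * w) *\<^sub>R c"
  proof -
    have "newton_acceleration 7 m r 7 =
      (m 1 / \<rho> ^ 3) *\<^sub>R (a) +
      (m 2 / \<rho> ^ 3) *\<^sub>R (b) +
      (m 3 / \<rho> ^ 3) *\<^sub>R (c) +
      (m 4 / \<rho> ^ 3) *\<^sub>R (- a) +
      (m 5 / \<rho> ^ 3) *\<^sub>R (- b) +
      (m 6 / \<rho> ^ 3) *\<^sub>R (- c)"
      unfolding newton_acceleration_def sum_upto_7_diff r
      by (intro arg_cong2[of _ _ _ _ "(+)"] force)
        (simp_all add: norms dbl neg diff)
    then show ?thesis
      by (simp add: k_def h_def w_def power_mult_distrib algebra_simps add_divide_distrib diff_divide_distrib)
  qed
  \<comment> \<open>The right-hand sides are expanded in the same basis. Along a given basis vector,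
    all bodies outside the corresponding pair, including body 7, get the same coefficient.\<close>
  have rel1: "lam *\<^sub>R (r 1 - center_of_mass 7 m r) =
      (lam * (1 - (m 1 - m 4) / M)) *\<^sub>R a +
      (lam * (- ((m 2 - m 5) / M))) *\<^sub>R b +
      (lam * (- ((m 3 - m 6) / M))) *\<^sub>R c" for lam
  proof -
    have offset: "r 1 - center_of_mass 7 m r = a - (center_of_mass 7 m r - r 7)"
      by (simp add: r del: One_nat_def)
    show ?thesis
      unfolding offset com by (simp add: algebra_simps)
  qed
  have rel2: "lam *\<^sub>R (r 2 - center_of_mass 7 m r) =
      (lam * (- ((m 1 - m 4) / M))) *\<^sub>R a +
      (lam * (1 - (m 2 - m 5) / M)) *\<^sub>R b +
      (lam * (- ((m 3 - m 6) / M))) *\<^sub>R c" for lam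
  proof -
    have offset: "r 2 - center_of_mass 7 m r = b - (center_of_mass 7 m r - r 7)"
      by (simp add: r del: One_nat_def)
    show ?thesis
      unfolding offset com by (simp add: algebra_simps)
  qed
  have rel3: "lam *\<^sub>R (r 3 - center_of_mass 7 m r) =
      (lam * (- ((m 1 - m 4) / M))) *\<^sub>R a +
      (lam * (- ((m 2 - m 5) / M))) *\<^sub>R b +
      (lam * (1 - (m 3 - m 6) / M)) *\<^sub>R c" for lam
  proof -
    have offset: "r 3 - center_of_mass 7 m r = c - (center_of_mass 7 m r - r 7)"
      by (simp add: r del: One_nat_def)
    show ?thesis
      unfolding offset com by (simp add: algebra_simps)
  qed
  have rel4: "lam *\<^sub>R (r 4 - center_of_mass 7 m r) =
      (lam * (- 1 - (m 1 - m 4) / M)) *\<^sub>R a +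
      (lam * (- ((m 2 - m 5) / M))) *\<^sub>R b +
      (lam * (- ((m 3 - m 6) / M))) *\<^sub>R c" for lam
  proof -
    have offset: "r 4 - center_of_mass 7 m r = - a - (center_of_mass 7 m r - r 7)"
      by (simp add: r del: One_nat_def)
    show ?thesis
      unfolding offset com by (simp add: algebra_simps)
  qed
  have rel5: "lam *\<^sub>R (r 5 - center_of_mass 7 m r) =
      (lam * (- ((m 1 - m 4) / M))) *\<^sub>R a +
      (lam * (- 1 - (m 2 - m 5) / M)) *\<^sub>R b +
      (lam * (- ((m 3 - m 6) / M))) *\<^sub>R c" for lam
  proof -
    have offset: "r 5 - center_of_mass 7 m r = - b - (center_of_mass 7 m r - r 7)"
      by (simp add: r del: One_nat_def)
    show ?thesis
      unfolding offset com by (simp add: algebra_simps)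
  qed
  have rel6: "lam *\<^sub>R (r 6 - center_of_mass 7 m r) =
      (lam * (- ((m 1 - m 4) / M))) *\<^sub>R a +
      (lam * (- ((m 2 - m 5) / M))) *\<^sub>R b +
      (lam * (- 1 - (m 3 - m 6) / M)) *\<^sub>R c" for lam
  proof -
    have offset: "r 6 - center_of_mass 7 m r = - c - (center_of_mass 7 m r - r 7)"
      by (simp add: r del: One_nat_def)
    show ?thesis
      unfolding offset com by (simp add: algebra_simps)
  qed
  have rel7: "lam *\<^sub>R (r 7 - center_of_mass 7 m r) =
      (lam * (- ((m 1 - m 4) / M))) *\<^sub>R a +
      (lam * (- ((m 2 - m 5) / M))) *\<^sub>R b +
      (lam * (- ((m 3 - m 6) / M))) *\<^sub>R c" for lam
  proof -
    have offset: "r 7 - center_of_mass 7 m r = 0 - (center_of_mass 7 m r - r 7)"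
      by (simp add: r del: One_nat_def)
    show ?thesis
      unfolding offset com by (simp add: algebra_simps)
  qed
  show ?thesis
  proof
    assume "central_configuration 7 m r"
    then obtain lam where lam: "\<forall>i\<in>{1..7}.
        newton_acceleration 7 m r i = lam *\<^sub>R (r i - center_of_mass 7 m r)"
      unfolding central_configuration_def by blast
    note eqs = lam[unfolded ball_upto_7 acc1 acc2 acc3 acc4 acc5 acc6 acc7
        rel1 rel2 rel3 rel4 rel5 rel6 rel7 indep]
    \<comment> \<open>Both sides equal \<open>- lam * (m 2 - m 5) / M\<close>: bodies 1 and 4 differ
      only in the coefficient of \<open>a\<close> on the right.\<close>
    have "m 2 * k - m 5 * h = m 2 * h - m 5 * k"
      using eqs by simp
    then have "(m 2 + m 5) * (k - h) = 0"
      by (simp add: algebra_simps)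
    with pos have "k = h"
      by auto
    then have "D ^ 3 = E ^ 3"
      using DE by (simp add: k_def h_def)
    then have "D = E"
      using DE by (simp add: power_eq_iff_eq_base)
    then have g: "g = 0"
      by (simp add: D_def E_def)
    have D: "D = sqrt 2 * \<rho>"
      by (simp add: D_def \<rho>_def g real_sqrt_mult)
    have w: "w = 2 * sqrt 2 * k"
    proof -
      have "D ^ 3 = 2 * sqrt 2 * \<rho> ^ 3"
        unfolding D power_mult_distrib by (simp add: power3_eq_cube)
      then show ?thesis
        by (simp add: w_def k_def)
    qed
    \<comment> \<open>The ratio \<open>w / k = 2 * sqrt 2\<close> lies strictly between 1 and 8. The
      lower bound serves for opposite masses, the upper one for the comparison of different
      pairs.\<close>
    have "1 < sqrt 2" "sqrt 2 < 2"
      using real_sqrt_less_iff[of 2 4] by simp_all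
    then have "1 < 2 * sqrt 2" "2 * sqrt 2 < 8"
      by linarith+
    from this[THEN mult_strict_right_mono, OF kw(1)] have "k < w" "w < 8 * k"
      by (simp_all add: w)
    \<comment> \<open>The first premise is one coordinate of body 7's equation, the second the same
      coordinate for one of bodies 1 to 3 outside that pair. Their right-hand sides
      coincide.\<close>
    have antipodal: "x = y"
      if "(x - y) * w = lam * - ((x - y) / M)" "x * k - y * h = lam * - ((x - y) / M)" for x y
    proof -
      have "(x - y) * (w - k) = 0"
        using that \<open>k = h\<close> by (simp add: algebra_simps)
      with \<open>k < w\<close> show ?thesis
        by simp
    qed
    have opp: "m 1 = m 4" "m 2 = m 5" "m 3 = m 6"
      by (rule antipodal; use eqs in blast)+
    \<comment> \<open>Once opposite masses agree, every radial right-hand side is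
      \<open>lam\<close>. A pair acts on its own bodies with weight \<open>w / 4\<close> and on
      those of another pair with weight \<open>2 * k\<close>, so swapping \<open>x\<close> and
      \<open>y\<close> changes the total unless they are equal.\<close>
    have same: "x = y"
      if "- ((y + z) * k + (y + z) * h + x * w / 4 + m 7 * w) =
        - ((x + z) * k + (x + z) * h + y * w / 4 + m 7 * w)" for x y z
    proof -
      have "(x - y) * (2 * k - w / 4) = 0"
        using that \<open>k = h\<close> by (simp add: algebra_simps diff_divide_distrib)
      moreover have "w / 4 < 2 * k"
        using \<open>w < 8 * k\<close> by simp
      ultimately show ?thesis
        by simp
    qed
    have radial:
      "- ((m 2 + m 3) * k + (m 5 + m 6) * h + m 4 * w / 4 + m 7 * w) = lam * (1 - (m 1 - m 4) / M)"
      "- ((m 1 + m 3) * k + (m 4 + m 6) * h + m 5 * w / 4 + m 7 * w) = lam * (1 - (m 2 - m 5) / M)"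
      "- ((m 1 + m 2) * k + (m 4 + m 5) * h + m 6 * w / 4 + m 7 * w) = lam * (1 - (m 3 - m 6) / M)"
      using eqs by blast+
    have "m 1 = m 2"
      by (rule same[where z = "m 6"]) (use radial(1,2) opp in simp)
    moreover have "m 2 = m 3"
      by (rule same[where z = "m 4"]) (use radial(2,3) opp in \<open>simp add: add.commute\<close>)
    ultimately show "m 1 = m 2 \<and> m 2 = m 3 \<and> m 3 = m 4 \<and> m 4 = m 5 \<and> m 5 = m 6 \<and> g = 0"
      using opp g by simp
  next
    assume asm: "m 1 = m 2 \<and> m 2 = m 3 \<and> m 3 = m 4 \<and> m 4 = m 5 \<and> m 5 = m 6 \<and> g = 0"
    then have "m 1 = m 6" "m 2 = m 6" "m 3 = m 6" "m 4 = m 6" "m 5 = m 6" "h = k"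
      by (simp_all add: k_def h_def D_def E_def)
    \<comment> \<open>The center of mass is now \<open>r 7\<close> and all transverse coefficients
      vanish. The multiplier is the radial coefficient: four neighbors with weight \<open>k\<close>,
      the opposite body and the center.\<close>
    then have "\<forall>i\<in>{1..7}. newton_acceleration 7 m r i =
        - (4 * m 6 * k + m 6 * w / 4 + m 7 * w) *\<^sub>R (r i - center_of_mass 7 m r)"
      unfolding ball_upto_7 acc1 acc2 acc3 acc4 acc5 acc6 acc7
        rel1 rel2 rel3 rel4 rel5 rel6 rel7 indep by simp
    with inj show "central_configuration 7 m r"
      unfolding central_configuration_def by blast
  qed
qed

section \<open>From the geometric hypotheses to vectors \<open>a\<close>, \<open>b\<close>,
  \<open>c\<close>\<close>

text \<open>By Pythagoras the foot of the perpendicular is a nearest point. This turns equidistance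
  from the planes into equidistance from the triangle centers.\<close>

lemma infdist_eq_dist_if_orthogonal:
  fixes p x :: "'a::euclidean_space"
  assumes "p \<in> P" "\<And>y. y \<in> P \<Longrightarrow> orthogonal (x - p) (y - p)"
  shows "infdist x P = dist x p"
proof (rule antisym)
  show "infdist x P \<le> dist x p"
    using assms(1) by (rule infdist_le)
  have "dist x p \<le> dist x y" if "y \<in> P" for y
  proof -
    have "(norm (x - y))\<^sup>2 = (norm (x - p))\<^sup>2 + (norm (y - p))\<^sup>2"
      using norm_add_Pythagorean[of "x - p" "p - y"] assms(2)[OF that]
      by (simp add: orthogonal_def inner_diff_right norm_minus_commute[of p y])
    then have "(dist x p)\<^sup>2 \<le> (dist x y)\<^sup>2"
      by (simp add: dist_norm)
    then show ?thesis
      by (rule power2_le_imp_le) simp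
  qed
  then show "dist x p \<le> infdist x P"
    using assms(1) by (auto simp: infdist_def intro!: cINF_greatest)
qed

text \<open>The axis meets the planes exactly in the triangle centers, so \<open>r 7\<close> is
  their midpoint and, by the labelling, the midpoint of each opposite pair. The Gram entries then
  follow from equal sides and from \<open>a + b + c\<close> being parallel to the axis.\<close>

lemma antiprism_coordinates:
  fixes P P' L :: "(real ^ 3) set" and r :: "nat \<Rightarrow> real ^ 3"
  assumes par: "affine_parallel P P'"
    and triangle1: "equilateral_triangle (r 1) (r 2) (r 3)" "{r 1, r 2, r 3} \<subseteq> P"
    and triangle2: "equilateral_triangle (r 4) (r 5) (r 6)" "{r 4, r 5, r 6} \<subseteq> P'"
    and planes: "affine P" "affine P'"
    and axis: "perpendicular L P"
      "triangle_center (r 1) (r 2) (r 3) \<in> L" "triangle_center (r 4) (r 5) (r 6) \<in> L"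
    and labels: "r 1 + r 4 = r 2 + r 5" "r 2 + r 5 = r 3 + r 6"
    and seventh: "\<exists>p\<in>L \<inter> P. \<exists>q\<in>L \<inter> P'. r 7 \<in> open_segment p q"
      "r 7 \<in> L" "infdist (r 7) P = infdist (r 7) P'"
  obtains a b c R g where "r 1 = r 7 + a" "r 2 = r 7 + b" "r 3 = r 7 + c"
      "r 4 = r 7 - a" "r 5 = r 7 - b" "r 6 = r 7 - c"
      "a \<bullet> a = R" "b \<bullet> b = R" "c \<bullet> c = R"
      "a \<bullet> b = g" "b \<bullet> c = g" "c \<bullet> a = g" "g < R" "R + 2 * g > 0"
proof -
  let ?u = "triangle_center (r 1) (r 2) (r 3)" and ?v = "triangle_center (r 4) (r 5) (r 6)"
  have centroid: "triangle_center x y z \<in> Q" if "affine Q" "{x, y, z} \<subseteq> Q" for x y z Q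
  proof -
    have "(1 / 3) *\<^sub>R x + (1 / 3) *\<^sub>R y + (1 / 3) *\<^sub>R z \<in> affine hull {x, y, z}"
      unfolding affine_hull_3 by force
    also have "affine hull {x, y, z} \<subseteq> Q"
      using that by (simp add: hull_minimal)
    finally show ?thesis
      by (simp add: triangle_center_def scaleR_add_right)
  qed
  have u: "?u \<in> P" and v: "?v \<in> P'"
    using triangle1 triangle2 planes by (auto intro!: centroid)
  have perp: "orthogonal (x - y) (p - q)" if "x \<in> L" "y \<in> L" "p \<in> P" "q \<in> P" for x y p q
    using axis(1) that by (simp add: perpendicular_def)
  obtain t where t: "P' = (+) t ` P"
    using par by (auto simp: affine_parallel_def)
  have perp': "orthogonal (x - y) (p - q)" if "x \<in> L" "y \<in> L" "p \<in> P'" "q \<in> P'" for x y p q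
    using perp that unfolding t by force
  obtain p q where p: "p \<in> L" "p \<in> P" and q: "q \<in> L" "q \<in> P'" and "r 7 \<in> open_segment p q"
    using seventh(1) by auto
  \<comment> \<open>The vector \<open>p - ?u\<close> lies both along the axis and in the plane, so
    it is orthogonal to itself.\<close>
  moreover have "p = ?u"
    using perp[OF p(1) axis(2) p(2) u] by (simp add: orthogonal_self)
  moreover have "q = ?v"
    using perp'[OF q(1) axis(3) q(2) v] by (simp add: orthogonal_self)
  ultimately have seg: "r 7 \<in> open_segment ?u ?v"
    by simp
  then obtain s where s: "0 < s" "s < 1" "r 7 = (1 - s) *\<^sub>R ?u + s *\<^sub>R ?v" and "?u \<noteq> ?v"
    by (auto simp: in_segment)
  have "infdist (r 7) P = dist (r 7) ?u" "infdist (r 7) P' = dist (r 7) ?v"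
    using perp[OF seventh(2) axis(2) _ u] perp'[OF seventh(2) axis(3) _ v]
    by (simp_all only: infdist_eq_dist_if_orthogonal[OF u] infdist_eq_dist_if_orthogonal[OF v])
  with seventh(3) have "dist (r 7) ?u = dist (r 7) ?v"
    by simp
  moreover have "r 7 - ?u = s *\<^sub>R (?v - ?u)" "r 7 - ?v = (1 - s) *\<^sub>R (?u - ?v)"
    unfolding s by (simp_all add: algebra_simps)
  \<comment> \<open>Comparing the distances to the two centers gives
    \<open>s = 1 / 2\<close>.\<close>
  ultimately have "s * norm (?v - ?u) = (1 - s) * norm (?u - ?v)"
    using s by (simp add: dist_norm)
  with \<open>?u \<noteq> ?v\<close> have "s = 1 - s"
    by (simp add: norm_minus_commute)
  then have "s = 1 / 2"
    by simp
  with s have mid: "2 *\<^sub>R r 7 = ?u + ?v"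
    by (simp add: algebra_simps)
  have triple: "x + x + x = 3 *\<^sub>R x" for x :: "real ^ 3"
    by (simp add: vec_eq_iff)
  \<comment> \<open>The three pair sums are equal, so each is one third of the total, namely
    \<open>?u + ?v\<close>.\<close>
  have "3 *\<^sub>R (?u + ?v) = (r 1 + r 4) + (r 2 + r 5) + (r 3 + r 6)"
    by (simp add: triangle_center_def algebra_simps)
  also have "\<dots> = 3 *\<^sub>R (r 1 + r 4)"
    by (simp only: labels triple)
  finally have sum: "r 1 + r 4 = 2 *\<^sub>R r 7" "r 2 + r 5 = 2 *\<^sub>R r 7" "r 3 + r 6 = 2 *\<^sub>R r 7"
    using mid labels by simp_all
  define a b c where "a = r 1 - r 7" and "b = r 2 - r 7" and "c = r 3 - r 7"
  have r: "r 1 = r 7 + a" "r 2 = r 7 + b" "r 3 = r 7 + c"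
      "r 4 = r 7 - a" "r 5 = r 7 - b" "r 6 = r 7 - c"
    using sum by (simp_all add: a_def b_def c_def scaleR_2 algebra_simps)
  have u': "?u - r 7 = (1 / 3) *\<^sub>R (a + b + c)"
    by (simp add: triangle_center_def a_def b_def c_def algebra_simps)
  have "orthogonal (?u - r 7) (r 1 - r 2)" "orthogonal (?u - r 7) (r 2 - r 3)"
    using triangle1 axis seventh by (auto intro!: perp)
  then have perps: "(a + b + c) \<bullet> (a - b) = 0" "(a + b + c) \<bullet> (b - c) = 0"
    unfolding u' by (simp_all add: orthogonal_def r del: One_nat_def)
  have "a \<noteq> b" and d: "norm (a - b) = norm (b - c)" "norm (b - c) = norm (c - a)"
    using triangle1 by (auto simp: equilateral_triangle_def r dist_norm simp del: One_nat_def)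
  from d have sq: "(a - b) \<bullet> (a - b) = (b - c) \<bullet> (b - c)" "(b - c) \<bullet> (b - c) = (c - a) \<bullet> (c - a)"
    by (simp_all add: norm_eq)
  note ip = inner_add_left inner_add_right inner_diff_left inner_diff_right
    inner_commute[of b a] inner_commute[of c b] inner_commute[of c a]
  \<comment> \<open>Perpendicularity gives \<open>a \<bullet> a - b \<bullet> b = b \<bullet> c - c
    \<bullet> a\<close>, while equal sides give \<open>b \<bullet> b - a \<bullet> a = 2 * (b
    \<bullet> c - c \<bullet> a)\<close>. Hence both differences vanish, and likewise for
    \<open>b\<close> and \<open>c\<close>.\<close>
  have gram: "a \<bullet> a = b \<bullet> b" "c \<bullet> c = b \<bullet> b" "b \<bullet> c = a \<bullet> b" "c \<bullet> a = a \<bullet> b"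
    using perps sq by (simp_all add: ip)
  have "0 < (a - b) \<bullet> (a - b)"
    using \<open>a \<noteq> b\<close> by simp
  then have "a \<bullet> b < b \<bullet> b"
    using gram by (simp add: ip)
  have "?u \<noteq> r 7"
    using seg by (auto simp: open_segment_def)
  then have "a + b + c \<noteq> 0"
    using u' by auto
  \<comment> \<open>This squared norm is \<open>3 * (R + 2 * g)\<close>; it is nonzero because
    \<open>r 7\<close> lies strictly between the centers.\<close>
  then have "0 < (a + b + c) \<bullet> (a + b + c)"
    by simp
  then have "b \<bullet> b + 2 * (a \<bullet> b) > 0"
    using gram by (simp add: ip)
  with r gram \<open>a \<bullet> b < b \<bullet> b\<close> that show thesis
    by blast
qed

theorem theorem1:
  fixes m :: "nat \<Rightarrow> real"
    and r :: "nat \<Rightarrow> real ^ 3"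
    and P P' L :: "(real ^ 3) set"
    and \<rho> :: "real ^ 3 \<Rightarrow> real ^ 3"
  assumes masses: "\<And>i. i \<in> {1..7} \<Longrightarrow> m i > 0"
    and planes: "is_plane P" "is_plane P'" "P' \<noteq> P" "affine_parallel P P'"
    and triangle1: "equilateral_triangle (r 1) (r 2) (r 3)" "{r 1, r 2, r 3} \<subseteq> P"
    and triangle2: "equilateral_triangle (r 4) (r 5) (r 6)" "{r 4, r 5, r 6} \<subseteq> P'"
    and axis: "is_line L" "perpendicular L P"
      "triangle_center (r 1) (r 2) (r 3) \<in> L" "triangle_center (r 4) (r 5) (r 6) \<in> L"
    and twist: "rotation_about L (pi / 3) \<rho>"
      "{r 4, r 5, r 6} = closest_point P' ` \<rho> ` {r 1, r 2, r 3}"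
    and labels: "r 1 + r 4 = r 2 + r 5" "r 2 + r 5 = r 3 + r 6"
    and seventh: "r 7 \<in> L" "\<exists>p\<in>L \<inter> P. \<exists>q\<in>L \<inter> P'. r 7 \<in> open_segment p q"
      "infdist (r 7) P = infdist (r 7) P'"
  shows "central_configuration 7 m r \<longleftrightarrow>
    m 1 = m 2 \<and> m 2 = m 3 \<and> m 3 = m 4 \<and> m 4 = m 5 \<and> m 5 = m 6 \<and>
    (\<exists>K. regular_octahedron (r 7) K \<and>
         {r 1, r 2, r 3, r 4, r 5, r 6} = polytope_vertices K)"
proof -
  have "affine P" "affine P'"
    using planes by (auto simp: is_plane_def)
  then obtain a b c R g where r: "r 1 = r 7 + a" "r 2 = r 7 + b" "r 3 = r 7 + c"
      "r 4 = r 7 - a" "r 5 = r 7 - b" "r 6 = r 7 - c"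
    and gram: "a \<bullet> a = R" "b \<bullet> b = R" "c \<bullet> c = R"
      "a \<bullet> b = g" "b \<bullet> c = g" "c \<bullet> a = g" "g < R" "R + 2 * g > 0"
    using antiprism_coordinates[OF planes(4) triangle1 triangle2 _ _ axis(2-4) labels
        seventh(2,1,3)] by metis
  have "R > 0"
    using gram by linarith
  have "a \<noteq> b"
    using gram by auto
  \<comment> \<open>Otherwise \<open>g = - R\<close>, so that \<open>R + 2 * g = - R\<close> would
    be negative.\<close>
  have "a \<noteq> - b"
  proof
    assume "a = - b"
    then have "g = - R"
      using gram by auto
    with gram \<open>R > 0\<close> show False
      by simp
  qed
  with \<open>R > 0\<close> \<open>a \<noteq> b\<close> gram have "(\<exists>K. regular_octahedron (r 7) K \<and>
      {r 1, r 2, r 3, r 4, r 5, r 6} = polytope_vertices K) \<longleftrightarrow> g = 0"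
    unfolding r by (intro regular_octahedron_vertices_iff[of _ "sqrt R"])
      (auto simp: norm_eq_sqrt_inner)
  then show ?thesis
    using antiprism_central_configuration_iff[OF masses r gram] by simp
qed

end
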